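(* Let $X^0,X^1,\dots,X^T\in\mathbb{R}^p$ be a fixed realization of a $\mathrm{VAR}(d)$ model $X^t=A_1X^{t-1}+\dots+A_dX^{t-d}+\varepsilon^t$ with error covariance $\Sigma_\varepsilon$, and let $N=T-d+1$, $q=dp^2$, $\mathcal{X}$, $Y$, $\beta^*$ be as defined in the context, where $\beta^*\in\mathbb{R}^q$ is $k$-sparse. Let $W=I_p$ or $W=\Sigma_\varepsilon^{-1}$, and put $\hat\Gamma=W\otimes(\mathcal{X}'\mathcal{X}/N)$ and $\hat\gamma=(W\otimes\mathcal{X}')Y/N$. Suppose that for some $\alpha>0$, $\tau>0$ with $k\tau\le\alpha/32$, $$\theta'\hat\Gamma\theta\ge\alpha\|\theta\|^2-\tau\|\theta\|_1^2\quad\text{for all }\theta\in\mathbb{R}^q,$$ and that for some deterministic quantity $\mathbb{Q}(\beta^*,\Sigma_\varepsilon)$, $$\|\hat\gamma-\hat\Gamma\beta^*\|_\infty\le\mathbb{Q}(\beta^*,\Sigma_\varepsilon)\sqrt{\frac{\log d+2\log p}{N}}.$$ Then, for any $\lambda_N>0$ with $\lambda_N\ge4\,\mathbb{Q}(\beta^*,\Sigma_\varepsilon)\sqrt{(\log d+2\log p)/N}$, any solution $$\hat\beta\in\operatorname*{argmin}_{\beta\in\mathbb{R}^q}\ -2\beta'\hat\gamma+\beta'\hat\Gamma\beta+\lambda_N\|\beta\|_1$$ satisfies $$\|\hat\beta-\beta^*\|_1\le64\,k\lambda_N/\alpha,\qquad\|\hat\beta-\beta^*\|\le16\sqrt k\,\lambda_N/\alpha,\qquad(\hat\beta-\beta^*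 )'\hat\Gamma(\hat\beta-\beta^* )\le128\,k\lambda_N^2/\alpha.$$ Further, the thresholded variant $\tilde\beta$ with $\tilde\beta_j=\hat\beta_j\mathbf{1}_{\{|\hat\beta_j|>\lambda_N\}}$ satisfies $$|\mathrm{supp}(\tilde\beta)\setminus\mathrm{supp}(\beta^* )|\le\frac{192\,k}{\alpha}.$$
   Context: $A_1,\dots,A_d$ are real $p\times p$ matrices and $\Sigma_\varepsilon$ is a $p\times p$ positive definite matrix. Write the data as the regression $\mathcal{Y}=\mathcal{X}B^*+E$, where $\mathcal{Y}$ is the $N\times p$ matrix with rows $(X^T)',(X^{T-1})',\dots,(X^d)'$; $\mathcal{X}$ is the $N\times dp$ matrix whose row corresponding to $(X^t)'$ is $((X^{t-1})',\dots,(X^{t-d})')$, $t=T,\dots,d$; $B^*=[A_1:\dots:A_d]'$ is $dp\times p$; $E$ has rows $(\varepsilon^T)',\dots,(\varepsilon^d)'$. Let $Y=\mathrm{vec}(\mathcal{Y})$ and $\beta^*=\mathrm{vec}(B^* )\in\mathbb{R}^q$, so that $Y=(I_p\otimes\mathcal{X})\beta^*+\mathrm{vec}(E)$; $\mathrm{vec}$ stacks columns. $k$-sparse means that $\beta^*$ has $k$ nonzero entries, i.e. $\sum_{t=1}^d\|\mathrm{vec}(A_t)\|_0=k$. $\|\cdot\|$, $\|\cdot\|_1$, $\|\cdot\|_\infty$ are the $\ell_2$, $\ell_1$, $\ell_\infty$ vector norms. *)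

theory Defs
  imports "HOL-Probability.Probability" "Jordan_Normal_Form.Matrix"
begin

text \<open>Vectors and matrices are those of \<open>Jordan_Normal_Form\<close>: dimensions are natural numbers and
  indices start at \<open>0\<close>. The notation of \<open>HOL-Analysis\<close> for its own vectors is switched off.\<close>

unbundle no vec_syntax and no inner_syntax

definition l1_norm :: "real vec \<Rightarrow> real" where
  "l1_norm v = (\<Sum>i<dim_vec v. \<bar>v $ i\<bar>)"

definition l2_norm :: "real vec \<Rightarrow> real" where
  "l2_norm v = sqrt (\<Sum>i<dim_vec v. (v $ i)\<^sup>2)"

text \<open>The inserted \<open>0\<close> only matters for the vector of dimension \<open>0\<close>.\<close>

definition linf_norm :: "real vec \<Rightarrow> real" where
  "linf_norm v = Max (insert 0 ((\<lambda>i. \<bar>v $ i\<bar>) ` {..<dim_vec v}))"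

definition supp :: "real vec \<Rightarrow> nat set" where
  "supp v = {i. i < dim_vec v \<and> v $ i \<noteq> 0}"

definition quad_form :: "real mat \<Rightarrow> real vec \<Rightarrow> real" where
  "quad_form G v = v \<bullet> (G *\<^sub>v v)"

definition pos_def_mat :: "nat \<Rightarrow> real mat \<Rightarrow> bool" where
  "pos_def_mat n S \<longleftrightarrow> S \<in> carrier_mat n n \<and> S\<^sup>T = S
     \<and> (\<forall>v \<in> carrier_vec n. v \<noteq> 0\<^sub>v n \<longrightarrow> 0 < quad_form S v)"

definition kronecker :: "real mat \<Rightarrow> real mat \<Rightarrow> real mat" where
  "kronecker A B = mat (dim_row A * dim_row B) (dim_col A * dim_col B)
     (\<lambda>(i, j). A $$ (i div dim_row B, j div dim_col B) * B $$ (i mod dim_row B, j mod dim_col B))"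

text \<open>The operator vec, which stacks the columns of a matrix.\<close>

definition stack_cols :: "real mat \<Rightarrow> real vec" where
  "stack_cols M = vec (dim_col M * dim_row M) (\<lambda>i. M $$ (i mod dim_row M, i div dim_row M))"

text \<open>Observations at times \<open>0, \<dots>, T\<close> from a \<open>p\<close>-dimensional VAR(\<open>d\<close>) model whose errors
  are white noise with covariance matrix \<open>\<Sigma>\<close>. Neither normality of the errors nor stability of
  the process is imposed.\<close>

locale var_model = prob_space M for M :: "'w measure" +
  fixes p d T :: nat
    and A :: "nat \<Rightarrow> real mat"
    and \<Sigma> :: "real mat"
    and X \<epsilon> :: "nat \<Rightarrow> 'w \<Rightarrow> real vec"
  assumes coeff_carrier: "\<And>j. j \<in> {1..d} \<Longrightarrow> A j \<in> carrier_mat p p"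
    and cov_pos_def: "pos_def_mat p \<Sigma>"
    and obs_carrier: "\<And>t \<omega>. t \<le> T \<Longrightarrow> \<omega> \<in> space M \<Longrightarrow> X t \<omega> \<in> carrier_vec p"
    and obs_rv: "\<And>t i. t \<le> T \<Longrightarrow> i < p \<Longrightarrow> random_variable borel (\<lambda>\<omega>. X t \<omega> $ i)"
    and err_carrier: "\<And>t \<omega>. t \<in> {d..T} \<Longrightarrow> \<omega> \<in> space M \<Longrightarrow> \<epsilon> t \<omega> \<in> carrier_vec p"
    and err_rv: "\<And>t i. t \<in> {d..T} \<Longrightarrow> i < p \<Longrightarrow> random_variable borel (\<lambda>\<omega>. \<epsilon> t \<omega> $ i)"
    and err_square_integrable:
      "\<And>t i. t \<in> {d..T} \<Longrightarrow> i < p \<Longrightarrow> integrable M (\<lambda>\<omega>. (\<epsilon> t \<omega> $ i)\<^sup>2)"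
    and err_centred: "\<And>t i. t \<in> {d..T} \<Longrightarrow> i < p \<Longrightarrow> expectation (\<lambda>\<omega>. \<epsilon> t \<omega> $ i) = 0"
    and err_cov: "\<And>s t i j. s \<in> {d..T} \<Longrightarrow> t \<in> {d..T} \<Longrightarrow> i < p \<Longrightarrow> j < p \<Longrightarrow>
        expectation (\<lambda>\<omega>. \<epsilon> s \<omega> $ i * \<epsilon> t \<omega> $ j) = (if s = t then \<Sigma> $$ (i, j) else 0)"
    and recursion: "\<And>t i \<omega>. t \<in> {d..T} \<Longrightarrow> \<omega> \<in> space M \<Longrightarrow> i < p \<Longrightarrow>
        X t \<omega> $ i = (\<Sum>j = 1..d. (A j *\<^sub>v X (t - j) \<omega>) $ i) + \<epsilon> t \<omega> $ i"

text \<open>Regression form of a realization \<open>x\<close>. Row \<open>i\<close> belongs to time \<open>T - i\<close>, and columns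
  \<open>l * p, \<dots>, l * p + p - 1\<close> of the design matrix to lag \<open>l + 1\<close>.\<close>

definition response_mat :: "nat \<Rightarrow> nat \<Rightarrow> nat \<Rightarrow> (nat \<Rightarrow> real vec) \<Rightarrow> real mat" where
  "response_mat p d T x = mat (T - d + 1) p (\<lambda>(i, j). x (T - i) $ j)"

definition design_mat :: "nat \<Rightarrow> nat \<Rightarrow> nat \<Rightarrow> (nat \<Rightarrow> real vec) \<Rightarrow> real mat" where
  "design_mat p d T x =
     mat (T - d + 1) (d * p) (\<lambda>(i, j). x (T - i - (j div p + 1)) $ (j mod p))"

text \<open>The matrix \<open>B\<^sup>* = [A\<^sub>1 : \<dots> : A\<^sub>d]'\<close>.\<close>

definition coeff_mat :: "nat \<Rightarrow> nat \<Rightarrow> (nat \<Rightarrow> real mat) \<Rightarrow> real mat" where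
  "coeff_mat p d A = (mat p (d * p) (\<lambda>(i, j). A (j div p + 1) $$ (i, j mod p)))\<^sup>T"

definition error_mat :: "nat \<Rightarrow> nat \<Rightarrow> nat \<Rightarrow> (nat \<Rightarrow> real vec) \<Rightarrow> real mat" where
  "error_mat p d T e = mat (T - d + 1) p (\<lambda>(i, j). e (T - i) $ j)"

text \<open>The regression \<open>\<Y> = \<X> B\<^sup>* + E\<close> in vectorized form.\<close>

lemma (in var_model) regression_form:
  assumes "1 \<le> p" "d \<le> T" and \<omega>: "\<omega> \<in> space M"
  defines "x \<equiv> (\<lambda>t. X t \<omega>)" and "e \<equiv> (\<lambda>t. \<epsilon> t \<omega>)"
  shows "stack_cols (response_mat p d T x) =
    kronecker (1\<^sub>m p) (design_mat p d T x) *\<^sub>v stack_cols (coeff_mat p d A)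
      + stack_cols (error_mat p d T e)"
proof (rule eq_vecI)
  let ?N = "T - d + 1"
  let ?K = "kronecker (1\<^sub>m p) (design_mat p d T x)"
  let ?b = "stack_cols (coeff_mat p d A)"
  have dimK: "dim_row ?K = p * ?N" "dim_col ?K = p * (d * p)"
    by (simp_all add: kronecker_def design_mat_def)
  have dimb: "dim_vec ?b = p * (d * p)"
    by (simp add: stack_cols_def coeff_mat_def)
  show "dim_vec (stack_cols (response_mat p d T x)) =
      dim_vec (?K *\<^sub>v ?b + stack_cols (error_mat p d T e))"
    by (simp add: stack_cols_def response_mat_def error_mat_def)
  fix n
  assume "n < dim_vec (?K *\<^sub>v ?b + stack_cols (error_mat p d T e))"
  then have n: "n < p * ?N"
    by (simp add: stack_cols_def error_mat_def)
  define r c where "r = n mod ?N" and "c = n div ?N"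
  have r: "r < ?N" unfolding r_def by simp
  have c: "c < p" unfolding c_def using n by (metis less_mult_imp_div_less)
  have rc: "n mod Suc (T - d) = r" "n div Suc (T - d) = c"
    by (simp_all add: r_def c_def)
  define t where "t = T - r"
  have t: "t \<in> {d..T}" using r \<open>d \<le> T\<close> unfolding t_def by auto
  have "(?K *\<^sub>v ?b) $ n = (\<Sum>m<p * (d * p). ?K $$ (n, m) * ?b $ m)"
    using n dimK dimb by (simp add: scalar_prod_def lessThan_atLeast0)
  also have "\<dots> = (\<Sum>m<p * (d * p). (if m div (d * p) = c then
      x (T - r - (m mod (d * p) div p + 1)) $ (m mod (d * p) mod p)
      * A (m mod (d * p) div p + 1) $$ (c, m mod (d * p) mod p) else 0))"
  proof (rule sum.cong[OF refl])
    fix m assume "m \<in> {..<p * (d * p)}"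
    then have m: "m < p * (d * p)" by simp
    then have "0 < d * p" by (cases "d * p") auto
    moreover have "m div (d * p) < p" using m by (metis less_mult_imp_div_less)
    ultimately show "?K $$ (n, m) * ?b $ m = (if m div (d * p) = c then
      x (T - r - (m mod (d * p) div p + 1)) $ (m mod (d * p) mod p)
      * A (m mod (d * p) div p + 1) $$ (c, m mod (d * p) mod p) else 0)"
      using m n r c by (auto simp: kronecker_def design_mat_def stack_cols_def coeff_mat_def rc)
  qed
  also have "\<dots> = (\<Sum>m<d * p. x (t - (m div p + 1)) $ (m mod p)
      * A (m div p + 1) $$ (c, m mod p))"
  proof -
    have "{m. m < p * (d * p) \<and> m div (d * p) = c} = (\<lambda>m. c * (d * p) + m) ` {..<d * p}"
      (is "?L = ?R")
    proof
      show "?L \<subseteq> ?R"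
      proof
        fix m assume m: "m \<in> ?L"
        then have "0 < d * p" by (cases "d * p") auto
        then have "m mod (d * p) < d * p" by simp
        moreover have "m = c * (d * p) + m mod (d * p)" using m
          by (metis (mono_tags, lifting) div_mult_mod_eq mem_Collect_eq)
        ultimately show "m \<in> ?R" by blast
      qed
      show "?R \<subseteq> ?L"
      proof
        fix m assume "m \<in> ?R"
        then obtain j where j: "j < d * p" "m = c * (d * p) + j" by auto
        have "m < (c + 1) * (d * p)" using j by simp
        also have "\<dots> \<le> p * (d * p)" using c by (intro mult_right_mono) auto
        finally have "m < p * (d * p)" .
        moreover have "m div (d * p) = c" using j by (intro div_nat_eqI) auto
        ultimately show "m \<in> ?L" by simp
      qed
    qed
    then show ?thesis
      by (simp add: t_def sum.If_cases Int_def sum.reindex)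
  qed
  also have "\<dots> = (\<Sum>l<d. \<Sum>i<p. x (t - (l + 1)) $ i * A (l + 1) $$ (c, i))"
  proof -
    have "(\<Sum>m = l * p..<l * p + p. x (t - (m div p + 1)) $ (m mod p)
          * A (m div p + 1) $$ (c, m mod p))
        = (\<Sum>i<p. x (t - (l + 1)) $ i * A (l + 1) $$ (c, i))" for l
      using sum.shift_bounds_nat_ivl[of "\<lambda>m. x (t - (m div p + 1)) $ (m mod p)
        * A (m div p + 1) $$ (c, m mod p)" 0 "l * p" p]
      by (simp add: lessThan_atLeast0 add.commute)
    then show ?thesis
      by (simp flip: sum.nat_group)
  qed
  also have "\<dots> = (\<Sum>l<d. (A (l + 1) *\<^sub>v x (t - (l + 1))) $ c)"
  proof (rule sum.cong[OF refl])
    fix l assume "l \<in> {..<d}"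
    then have "A (l + 1) \<in> carrier_mat p p" "x (t - (l + 1)) \<in> carrier_vec p"
      using coeff_carrier[of "l + 1"] obs_carrier[OF _ \<omega>] t by (auto simp: x_def)
    then show "(\<Sum>i<p. x (t - (l + 1)) $ i * A (l + 1) $$ (c, i))
        = (A (l + 1) *\<^sub>v x (t - (l + 1))) $ c"
      using c by (auto simp: scalar_prod_def lessThan_atLeast0 mult.commute intro!: sum.cong)
  qed
  also have "\<dots> = (\<Sum>j = 1..d. (A j *\<^sub>v x (t - j)) $ c)"
    by (rule sum.reindex_bij_witness[of _ "\<lambda>j. j - 1" "\<lambda>l. l + 1"]) auto
  finally show "stack_cols (response_mat p d T x) $ n =
      (?K *\<^sub>v ?b + stack_cols (error_mat p d T e)) $ n"
    using recursion[OF t \<omega> c] n r c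
    by (simp add: stack_cols_def response_mat_def error_mat_def x_def e_def t_def rc)
qed

definition Gamma_hat :: "nat \<Rightarrow> nat \<Rightarrow> nat \<Rightarrow> (nat \<Rightarrow> real vec) \<Rightarrow> real mat \<Rightarrow> real mat" where
  "Gamma_hat p d T x W =
     kronecker W ((1 / real (T - d + 1)) \<cdot>\<^sub>m ((design_mat p d T x)\<^sup>T * design_mat p d T x))"

definition gamma_hat :: "nat \<Rightarrow> nat \<Rightarrow> nat \<Rightarrow> (nat \<Rightarrow> real vec) \<Rightarrow> real mat \<Rightarrow> real vec" where
  "gamma_hat p d T x W = (1 / real (T - d + 1)) \<cdot>\<^sub>v
     (kronecker W ((design_mat p d T x)\<^sup>T) *\<^sub>v stack_cols (response_mat p d T x))"

definition lasso_objective :: "real mat \<Rightarrow> real vec \<Rightarrow> real \<Rightarrow> real vec \<Rightarrow> real" where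
  "lasso_objective G g l b = - 2 * (b \<bullet> g) + quad_form G b + l * l1_norm b"

definition threshold :: "real \<Rightarrow> real vec \<Rightarrow> real vec" where
  "threshold l b = vec (dim_vec b) (\<lambda>j. if \<bar>b $ j\<bar> > l then b $ j else 0)"

end

theory Submission
  imports Defs
begin

subsection \<open>Quadratic forms of symmetric matrices\<close>

text \<open>Position \<open>a * n + r\<close> is entry \<open>r\<close> of block \<open>a\<close>,
  the layout used by \<open>kronecker\<close>; this rewrites sums over a Kronecker index as sums
  over blocks.\<close>

lemma sum_lessThan_mult:
  fixes f :: "nat \<Rightarrow> 'a::comm_monoid_add"
  shows "(\<Sum>i<m * n. f i) = (\<Sum>a<m. \<Sum>r<n. f (a * n + r))"
proof -
  have "sum f {a * n..<a * n + n} = (\<Sum>r<n. f (a * n + r))" for a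
    using sum.shift_bounds_nat_ivl[of f 0 "a * n" n]
    by (simp add: lessThan_atLeast0 add.commute)
  then show ?thesis
    by (simp flip: sum.nat_group)
qed

lemma quad_form_sum:
  assumes "G \<in> carrier_mat n n" "v \<in> carrier_vec n"
  shows "quad_form G v = (\<Sum>i<n. \<Sum>j<n. v $ i * G $$ (i, j) * v $ j)"
  using assms
  by (auto simp: quad_form_def scalar_prod_def lessThan_atLeast0 sum_distrib_left mult.assoc
      intro!: sum.cong)

text \<open>Exact second-order expansion around \<open>v\<close>: symmetry of \<open>G\<close>
  merges the two cross terms. It serves to compare the objective at the minimizer with its value at
  the true parameter.\<close>

lemma quad_form_diff:
  assumes G: "G \<in> carrier_mat n n" "G\<^sup>T = G"
    and v: "u \<in> carrier_vec n" "v \<in> carrier_vec n"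
  shows "quad_form G u = quad_form G v + 2 * ((u - v) \<bullet> (G *\<^sub>v v)) + quad_form G (u - v)"
proof -
  define h where "h = u - v"
  have h: "h \<in> carrier_vec n" and u: "u = v + h"
    using v by (auto simp: h_def)
  have "v \<bullet> (G *\<^sub>v h) = h \<bullet> (G *\<^sub>v v)"
    using transpose_vec_mult_scalar[OF G(1) h v(2)] G h v(2)
    by (metis comm_scalar_prod mult_mat_vec_carrier)
  moreover have "quad_form G (v + h)
      = v \<bullet> (G *\<^sub>v v) + v \<bullet> (G *\<^sub>v h) + (h \<bullet> (G *\<^sub>v v) + h \<bullet> (G *\<^sub>v h))"
    using G(1) h v(2) unfolding quad_form_def
    by (simp add: mult_add_distrib_mat_vec[OF G(1)] add_scalar_prod_distrib[of _ n]
        scalar_prod_add_distrib[of _ n])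
  ultimately have "quad_form G (v + h) = quad_form G v + 2 * (h \<bullet> (G *\<^sub>v v)) + quad_form G h"
    by (simp add: quad_form_def)
  then show ?thesis
    unfolding u[symmetric] unfolding h_def .
qed

section \<open>Kronecker products with a Gram matrix\<close>

lemma kronecker_transpose:
  "(kronecker A B)\<^sup>T = kronecker A\<^sup>T B\<^sup>T"
proof (rule eq_matI)
  fix i j
  assume "i < dim_row (kronecker A\<^sup>T B\<^sup>T)" "j < dim_col (kronecker A\<^sup>T B\<^sup>T)"
  then have ij: "i < dim_col A * dim_col B" "j < dim_row A * dim_row B"
    by (auto simp: kronecker_def)
  \<comment> \<open>A product exceeding some index has nonzero factors; positivity is what bounds
    the remainders modulo the dimensions of \<open>B\<close>.\<close>
  then have "0 < dim_col B" "0 < dim_row B"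
    by (auto intro: gr0I)
  with ij show "(kronecker A B)\<^sup>T $$ (i, j) = kronecker A\<^sup>T B\<^sup>T $$ (i, j)"
    by (simp add: kronecker_def less_mult_imp_div_less)
qed (auto simp: kronecker_def)

text \<open>For a row \<open>x\<close> of \<open>C\<close>, the vector \<open>u\<close> with entries \<open>u\<^sub>a = \<Sum>\<^sub>r x\<^sub>r v\<^sub>a\<^sub>r\<close> contributes
  \<open>u' A u\<close> to the quadratic form.\<close>

lemma quad_form_kronecker_gram_nonneg:
  assumes A: "A \<in> carrier_mat m m"
    and nonneg: "\<And>u. u \<in> carrier_vec m \<Longrightarrow> 0 \<le> quad_form A u"
    and C: "C \<in> carrier_mat l n" and c: "0 \<le> c"
    and v: "v \<in> carrier_vec (m * n)"
  shows "0 \<le> quad_form (kronecker A (c \<cdot>\<^sub>m (C\<^sup>T * C))) v"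
proof -
  define u where "u t = vec m (\<lambda>a. \<Sum>r<n. C $$ (t, r) * v $ (a * n + r))" for t
  have gram: "(C\<^sup>T * C) $$ (r, s) = (\<Sum>t<l. C $$ (t, r) * C $$ (t, s))" if "r < n" "s < n" for r s
    using that C by (auto simp: scalar_prod_def lessThan_atLeast0 intro!: sum.cong)
  let ?K = "kronecker A (c \<cdot>\<^sub>m (C\<^sup>T * C))"
  have K: "?K \<in> carrier_mat (m * n) (m * n)"
    using A C by (auto simp: kronecker_def)
  have entry: "?K $$ (a * n + r, b * n + s) = A $$ (a, b) * (c * (\<Sum>t<l. C $$ (t, r) * C $$ (t, s)))"
    if "a < m" "b < m" "r < n" "s < n" for a b r s
  proof -
    have "x * n + y < m * n" if "x < m" "y < n" for x y
    proof -
      have "x * n + y < Suc x * n" using that by simp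
      also have "\<dots> \<le> m * n" using that by (intro mult_right_mono) auto
      finally show ?thesis .
    qed
    then show ?thesis
      using that A C gram[of r s] by (simp add: kronecker_def)
  qed
  have "quad_form ?K v = (\<Sum>a<m. \<Sum>r<n. \<Sum>b<m. \<Sum>s<n.
      v $ (a * n + r) * ?K $$ (a * n + r, b * n + s) * v $ (b * n + s))"
    by (simp add: quad_form_sum[OF K v] sum_lessThan_mult)
  also have "\<dots> = (\<Sum>a<m. \<Sum>r<n. \<Sum>b<m. \<Sum>s<n. \<Sum>t<l. c * A $$ (a, b) *
      ((C $$ (t, r) * v $ (a * n + r)) * (C $$ (t, s) * v $ (b * n + s))))"
    by (intro sum.cong refl) (simp add: entry sum_distrib_left sum_distrib_right mult_ac)
  \<comment> \<open>The sum over the rows \<open>t\<close> of \<open>C\<close> has to move outside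
    those over \<open>r\<close> and \<open>s\<close>; for fixed \<open>a\<close>, \<open>b\<close>
    and \<open>t\<close> the latter then factor into \<open>u t $ a\<close> and
    \<open>u t $ b\<close>.\<close>
  also have "\<dots> = (\<Sum>a<m. \<Sum>b<m. \<Sum>r<n. \<Sum>t<l. \<Sum>s<n. c * A $$ (a, b) *
      ((C $$ (t, r) * v $ (a * n + r)) * (C $$ (t, s) * v $ (b * n + s))))"
    by (intro sum.cong refl trans[OF sum.swap[of _ "{..<m}" "{..<n}"]] sum.swap)
  also have "\<dots> = (\<Sum>a<m. \<Sum>b<m. \<Sum>t<l. \<Sum>r<n. \<Sum>s<n. c * A $$ (a, b) *
      ((C $$ (t, r) * v $ (a * n + r)) * (C $$ (t, s) * v $ (b * n + s))))"
    by (intro sum.cong refl sum.swap)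
  also have "\<dots> = (\<Sum>a<m. \<Sum>b<m. \<Sum>t<l. c * (u t $ a * A $$ (a, b) * u t $ b))"
    by (intro sum.cong refl)
      (simp add: u_def sum_product sum_distrib_left mult_ac)
  also have "\<dots> = (\<Sum>a<m. \<Sum>t<l. \<Sum>b<m. c * (u t $ a * A $$ (a, b) * u t $ b))"
    by (intro sum.cong refl sum.swap)
  also have "\<dots> = (\<Sum>t<l. \<Sum>a<m. \<Sum>b<m. c * (u t $ a * A $$ (a, b) * u t $ b))"
    by (rule sum.swap)
  also have "\<dots> = (\<Sum>t<l. c * quad_form A (u t))"
    by (simp add: quad_form_sum[OF A] u_def sum_distrib_left)
  also have "0 \<le> \<dots>"
    using c by (intro sum_nonneg mult_nonneg_nonneg nonneg) (auto simp: u_def)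
  finally show ?thesis .
qed

section \<open>Positive definite matrices and their inverses\<close>

lemma mult_mat_vec_zero:
  "G \<in> carrier_mat m n \<Longrightarrow> G *\<^sub>v 0\<^sub>v n = (0\<^sub>v m :: 'a::semiring_0 vec)"
  by (intro eq_vecI) (auto simp: scalar_prod_def)

text \<open>Transposing \<open>S * W = 1\<^sub>m n\<close> makes the transpose of \<open>W\<close> a
  left inverse of \<open>S\<close>, so it coincides with \<open>W\<close>. For positivity substitute
  \<open>w = W *\<^sub>v v\<close>: the form of \<open>W\<close> at \<open>v\<close> is that of
  \<open>S\<close> at \<open>w\<close>, and \<open>w\<close> is nonzero because \<open>S\<close>
  maps it back to \<open>v\<close>.\<close>

lemma pos_def_mat_inverse:
  assumes S: "pos_def_mat n S" and W: "W \<in> carrier_mat n n" and inv: "S * W = 1\<^sub>m n"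
  shows "W\<^sup>T = W" "pos_def_mat n W"
proof -
  have Sc: "S \<in> carrier_mat n n" and ST: "S\<^sup>T = S"
    using S by (auto simp: pos_def_mat_def)
  have "W\<^sup>T * S = 1\<^sub>m n"
    using transpose_mult[OF Sc W] by (simp add: ST inv)
  then have "W = (W\<^sup>T * S) * W"
    using W by simp
  also have "\<dots> = W\<^sup>T * (S * W)"
    using W Sc by (intro assoc_mult_mat) auto
  finally show sym: "W\<^sup>T = W"
    using W by (simp add: inv)
  have "0 < quad_form W v" if v: "v \<in> carrier_vec n" "v \<noteq> 0\<^sub>v n" for v
  proof -
    have Wv: "W *\<^sub>v v \<in> carrier_vec n" using W v by auto
    have SWv: "S *\<^sub>v (W *\<^sub>v v) = v"
      using assoc_mult_mat_vec[OF Sc W v(1)] v by (simp add: inv)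
    then have "W *\<^sub>v v \<noteq> 0\<^sub>v n"
      using Sc v by (metis mult_mat_vec_zero)
    then have "0 < quad_form S (W *\<^sub>v v)"
      using S Wv by (auto simp: pos_def_mat_def)
    also have "\<dots> = quad_form W v"
      using comm_scalar_prod[OF Wv v(1)] by (simp add: quad_form_def SWv)
    finally show ?thesis .
  qed
  then show "pos_def_mat n W"
    using W sym by (auto simp: pos_def_mat_def)
qed

lemma pos_def_mat_one: "pos_def_mat n (1\<^sub>m n)"
proof -
  have "0 < v \<bullet> v" if v: "v \<in> carrier_vec n" "v \<noteq> 0\<^sub>v n" for v :: "real vec"
  proof -
    obtain i where "i < n" "v $ i \<noteq> 0"
      using v by (metis carrier_vecD eq_vecI index_zero_vec)
    then show ?thesis
      using v(1) by (auto simp: scalar_prod_def zero_less_mult_iff not_less linorder_neq_iff intro!: sum_pos2[of _ i])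
  qed
  then show ?thesis
    by (auto simp: pos_def_mat_def quad_form_def)
qed

lemma quad_form_nonneg:
  assumes "pos_def_mat n G" "v \<in> carrier_vec n"
  shows "0 \<le> quad_form G v"
proof (cases "v = 0\<^sub>v n")
  case True
  then show ?thesis
    using assms by (auto simp: pos_def_mat_def quad_form_def mult_mat_vec_zero)
next
  case False
  then show ?thesis
    using assms by (simp add: pos_def_mat_def less_imp_le)
qed

subsection \<open>The deterministic error bounds\<close>

text \<open>Hoelder's inequality for the dual pair of norms; it turns a sup-norm bound on the noise
  into a bound on the linear term of the lasso.\<close>

lemma scalar_prod_le_l1_linf:
  assumes "v \<in> carrier_vec n" "w \<in> carrier_vec n"
  shows "v \<bullet> w \<le> l1_norm v * linf_norm w"
proof -
  have "v \<bullet> w = (\<Sum>i<n. v $ i * w $ i)"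
    using assms by (simp add: scalar_prod_def lessThan_atLeast0)
  also have "\<dots> \<le> (\<Sum>i<n. \<bar>v $ i\<bar> * linf_norm w)"
  proof (rule sum_mono)
    fix i assume "i \<in> {..<n}"
    then have w: "\<bar>w $ i\<bar> \<le> linf_norm w"
      using assms unfolding linf_norm_def by (intro Max_ge) auto
    have "v $ i * w $ i \<le> \<bar>v $ i\<bar> * \<bar>w $ i\<bar>"
      by (simp flip: abs_mult)
    also have "\<dots> \<le> \<bar>v $ i\<bar> * linf_norm w"
      using w by (intro mult_left_mono) auto
    finally show "v $ i * w $ i \<le> \<bar>v $ i\<bar> * linf_norm w" .
  qed
  finally show ?thesis
    using assms by (simp add: l1_norm_def sum_distrib_right)
qed

text \<open>Cauchy-Schwarz against the constant 1 on \<open>J\<close>. With \<open>J\<close> the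
  support of the true parameter, this is the source of the factor
  \<open>sqrt (real k)\<close>.\<close>

lemma sum_abs_le_sqrt_card_l2_norm:
  assumes "J \<subseteq> {..<dim_vec v}"
  shows "(\<Sum>i\<in>J. \<bar>v $ i\<bar>) \<le> sqrt (real (card J)) * l2_norm v"
proof -
  have fin: "finite J"
    using assms by (rule finite_subset) simp
  have "(\<Sum>i\<in>J. \<bar>v $ i\<bar>) = (\<Sum>i\<in>J. \<bar>1\<bar> * \<bar>v $ i\<bar>)" by simp
  also have "\<dots> \<le> L2_set (\<lambda>_. 1) J * L2_set (\<lambda>i. v $ i) J"
    by (rule L2_set_mult_ineq)
  also have "\<dots> \<le> sqrt (real (card J)) * l2_norm v"
    unfolding L2_set_def l2_norm_def using assms fin
    by (auto intro!: mult_left_mono sum_mono2)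
  finally show ?thesis .
qed

text \<open>The lasso argument: optimality of the minimizer puts the error into the cone in which the
  \<open>\<ell>\<^sub>1\<close> mass off the support is at most three times the mass on the support; there the
  \<open>\<ell>\<^sub>1\<close> term of the restricted eigenvalue condition costs at most half of the curvature.\<close>

lemma lasso_error_bounds:
  assumes G: "G \<in> carrier_mat n n" "G\<^sup>T = G"
    and nonneg: "\<And>v. v \<in> carrier_vec n \<Longrightarrow> 0 \<le> quad_form G v"
    and g: "g \<in> carrier_vec n" and b: "b \<in> carrier_vec n"
    and k: "card (supp b) = k"
    and \<alpha>: "\<alpha> > 0" and \<tau>: "\<tau> \<ge> 0" "real k * \<tau> \<le> \<alpha> / 32"
    and re: "\<And>v. v \<in> carrier_vec n \<Longrightarrow>
      quad_form G v \<ge> \<alpha> * (l2_norm v)\<^sup>2 - \<tau> * (l1_norm v)\<^sup>2"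
    and lam: "lam > 0" and dev: "linf_norm (g - G *\<^sub>v b) \<le> lam / 4"
    and bhat: "is_arg_min (lasso_objective G g lam) (\<lambda>v. v \<in> carrier_vec n) bhat"
  shows "l1_norm (bhat - b) \<le> 12 * real k * lam / \<alpha>"
    and "l2_norm (bhat - b) \<le> 3 * sqrt (real k) * lam / \<alpha>"
    and "quad_form G (bhat - b) \<le> 9 / 2 * real k * lam\<^sup>2 / \<alpha>"
    and "real (card (supp (threshold lam bhat) - supp b)) \<le> 9 * real k / \<alpha>"
proof -
  have bh: "bhat \<in> carrier_vec n"
    and opt: "lasso_objective G g lam bhat \<le> lasso_objective G g lam b"
    using bhat b by (auto simp: is_arg_min_linorder)
  define v J D S where "v = bhat - b" and "J = supp b"
    and "D = (\<Sum>i\<in>{..<n} - J. \<bar>v $ i\<bar>)" and "S = (\<Sum>i\<in>J. \<bar>v $ i\<bar>)"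
  have v: "v \<in> carrier_vec n" and vi: "\<And>i. i < n \<Longrightarrow> v $ i = bhat $ i - b $ i"
    using b bh by (auto simp: v_def)
  have J: "J \<subseteq> {..<n}"
    using b by (auto simp: J_def supp_def)
  have off: "b $ i = 0" if "i \<in> {..<n} - J" for i
    using that b by (auto simp: J_def supp_def)
  have split: "(\<Sum>i<n. f i) = (\<Sum>i\<in>{..<n} - J. f i) + (\<Sum>i\<in>J. f i)" for f :: "nat \<Rightarrow> real"
    by (rule sum.subset_diff[OF J]) simp
  have l1: "l1_norm v = D + S"
    using v by (simp add: l1_norm_def split D_def S_def)
  have D0: "D \<ge> 0" and S0: "S \<ge> 0"
    by (auto simp: D_def S_def intro: sum_nonneg)
  have "l1_norm b - l1_norm bhat = (\<Sum>i<n. \<bar>b $ i\<bar> - \<bar>bhat $ i\<bar>)"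
    using b bh by (simp add: l1_norm_def sum_subtractf)
  \<comment> \<open>Off the support \<open>b\<close> vanishes and the two sides agree termwise; on
    the support this is the triangle inequality.\<close>
  also have "\<dots> \<le> (\<Sum>i\<in>{..<n} - J. - \<bar>v $ i\<bar>) + (\<Sum>i\<in>J. \<bar>v $ i\<bar>)"
    unfolding split
  proof (intro add_mono sum_mono)
    fix i assume "i \<in> {..<n} - J"
    then show "\<bar>b $ i\<bar> - \<bar>bhat $ i\<bar> \<le> - \<bar>v $ i\<bar>"
      using off[of i] vi[of i] by simp
  next
    fix i assume "i \<in> J"
    then show "\<bar>b $ i\<bar> - \<bar>bhat $ i\<bar> \<le> \<bar>v $ i\<bar>"
      using J vi[of i] by auto
  qed
  finally have l1_diff: "l1_norm b - l1_norm bhat \<le> S - D"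
    by (simp add: D_def S_def sum_negf)
  have Gb: "G *\<^sub>v b \<in> carrier_vec n"
    using G b by auto
  have "v \<bullet> (g - G *\<^sub>v b) \<le> l1_norm v * linf_norm (g - G *\<^sub>v b)"
    using v g Gb by (intro scalar_prod_le_l1_linf) auto
  also have "\<dots> \<le> l1_norm v * (lam / 4)"
    using dev D0 S0 by (intro mult_left_mono) (auto simp: l1)
  finally have "v \<bullet> (g - G *\<^sub>v b) \<le> l1_norm v * (lam / 4)" .
  moreover have "v \<bullet> (g - G *\<^sub>v b) = v \<bullet> g - v \<bullet> (G *\<^sub>v b)"
    using v g Gb by (rule scalar_prod_minus_distrib)
  moreover have "bhat \<bullet> g - b \<bullet> g = v \<bullet> g"
    unfolding v_def using minus_scalar_prod_distrib[OF bh b g] by simp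
  moreover have "quad_form G bhat = quad_form G b + 2 * (v \<bullet> (G *\<^sub>v b)) + quad_form G v"
    unfolding v_def by (rule quad_form_diff[OF G bh b])
  \<comment> \<open>Optimality with \<open>quad_form G b\<close> cancelled: the linear terms combine
    to twice the product of \<open>v\<close> with the noise
    \<open>g - G *\<^sub>v b\<close>.\<close>
  ultimately have "quad_form G v \<le> 2 * ((D + S) * (lam / 4)) + lam * (l1_norm b - l1_norm bhat)"
    using opt unfolding lasso_objective_def l1 by (simp add: algebra_simps add_divide_distrib)
  also have "\<dots> \<le> 2 * ((D + S) * (lam / 4)) + lam * (S - D)"
    using l1_diff lam by (intro add_left_mono mult_left_mono) auto
  also have "\<dots> = lam * (3 / 2 * S - D / 2)"
    by (simp add: field_simps)
  finally have basic: "quad_form G v \<le> lam * (3 / 2 * S - D / 2)" .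
  \<comment> \<open>Nonnegativity of the form on the whole space is used here: the restricted
    eigenvalue bound may be negative outside the cone. The cone constant 3 is the ratio of 3/2 to
    1/2.\<close>
  have "0 \<le> lam * (3 / 2 * S - D / 2)"
    using basic nonneg[OF v] by linarith
  then have cone: "D \<le> 3 * S"
    using lam by (simp add: zero_le_mult_iff)
  define L s where "L = l2_norm v" and "s = sqrt (real k)"
  have s: "s \<ge> 0" "s * s = real k" and L: "0 \<le> L"
    by (auto simp: s_def L_def l2_norm_def intro: sum_nonneg)
  have SL: "S \<le> s * L"
    using sum_abs_le_sqrt_card_l2_norm[of J v] J v k by (simp add: S_def s_def L_def J_def)
  have l1L: "l1_norm v \<le> 4 * (s * L)"
    using l1 cone SL by simp
  have upper: "quad_form G v \<le> lam * (3 / 2 * (s * L))"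
    using basic SL D0 lam mult_left_mono[of "3 / 2 * S - D / 2" "3 / 2 * (s * L)" lam] by linarith
  \<comment> \<open>In the cone the \<open>\<ell>\<^sub>1\<close> norm is at most
    \<open>4 * S\<close>; squaring gives 16, and the bound \<alpha>/32 on
    \<open>real k * \<tau>\<close> then leaves half of the curvature \<alpha>.\<close>
  have "\<tau> * (l1_norm v)\<^sup>2 \<le> \<tau> * (4 * (s * L))\<^sup>2"
    using l1L l1 D0 S0 \<tau> by (intro mult_left_mono power_mono) auto
  also have "\<dots> = 16 * (real k * \<tau>) * L\<^sup>2"
    by (simp add: power2_eq_square flip: s(2))
  also have "\<dots> \<le> 16 * (\<alpha> / 32) * L\<^sup>2"
    using \<tau> by (intro mult_right_mono mult_left_mono) auto
  finally have "\<alpha> / 2 * L\<^sup>2 \<le> lam * (3 / 2 * (s * L))"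
    using re[OF v] upper by (simp add: L_def)
  \<comment> \<open>One factor \<open>L\<close> is common to both sides and is cancelled; for
    \<open>L = 0\<close> the resulting bound is immediate.\<close>
  then have "L * (\<alpha> * L) \<le> L * (3 * s * lam)"
    by (simp add: power2_eq_square algebra_simps)
  then have "\<alpha> * L \<le> 3 * s * lam"
    using L lam s by (cases "L = 0") auto
  then have L_le: "L \<le> 3 * s * lam / \<alpha>"
    using \<alpha> by (simp add: field_simps)
  then show "l2_norm (bhat - b) \<le> 3 * sqrt (real k) * lam / \<alpha>"
    by (simp add: L_def s_def v_def)
  have sL: "s * L \<le> 3 * real k * lam / \<alpha>"
    using mult_left_mono[OF L_le s(1)] by (simp flip: s(2) add: mult_ac)
  show "l1_norm (bhat - b) \<le> 12 * real k * lam / \<alpha>"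
    using l1L sL by (simp add: v_def)
  show "quad_form G (bhat - b) \<le> 9 / 2 * real k * lam\<^sup>2 / \<alpha>"
  proof -
    have "lam * (3 / 2 * (s * L)) \<le> lam * (3 / 2 * (3 * real k * lam / \<alpha>))"
      using sL lam by (intro mult_left_mono) auto
    with upper have "quad_form G v \<le> lam * (3 / 2 * (3 * real k * lam / \<alpha>))"
      by (rule order_trans)
    also have "\<dots> = 9 / 2 * real k * lam\<^sup>2 / \<alpha>"
      by (simp add: power2_eq_square)
    finally show ?thesis
      by (simp add: v_def)
  qed
  define F where "F = supp (threshold lam bhat) - J"
  have F: "F \<subseteq> {..<n} - J"
    using bh by (auto simp: F_def supp_def threshold_def)
  have F_lam: "lam \<le> \<bar>v $ i\<bar>" if "i \<in> F" for i
  proof -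
    have i: "i \<in> {..<n} - J" using that F by blast
    have "lam < \<bar>bhat $ i\<bar>"
      using that bh by (auto simp: F_def supp_def threshold_def split: if_splits)
    then show ?thesis
      using off[OF i] vi[of i] i by simp
  qed
  \<comment> \<open>Markov-type counting: each false positive has \<open>b $ i = 0\<close>, so its
    error is the estimate itself and exceeds \<open>lam\<close> in size, while all these errors sum
    to at most \<open>D\<close>.\<close>
  have "real (card F) * lam \<le> (\<Sum>i\<in>F. \<bar>v $ i\<bar>)"
    using F_lam by (intro sum_bounded_below) auto
  also have "\<dots> \<le> D"
    unfolding D_def using F by (intro sum_mono2) auto
  \<comment> \<open>The chain is \<open>D \<le> 3 * S\<close> with \<open>S \<le> s * L\<close>; the
    remaining factor \<open>lam\<close> cancels, so the count does not depend on the penalty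
    level.\<close>
  also have "\<dots> \<le> (9 * real k / \<alpha>) * lam"
    using order_trans[OF cone, of "3 * (3 * real k * lam / \<alpha>)"] SL sL by simp
  finally show "real (card (supp (threshold lam bhat) - supp b)) \<le> 9 * real k / \<alpha>"
    using lam unfolding F_def J_def by (rule mult_right_le_imp_le)
qed

section \<open>Application to the vectorized VAR regression\<close>

theorem proposition4p1:
  fixes M :: "'w measure" and \<omega> :: 'w
    and p d T N q k :: nat
    and A :: "nat \<Rightarrow> real mat"
    and \<Sigma> W \<Gamma> :: "real mat"
    and X \<epsilon> :: "nat \<Rightarrow> 'w \<Rightarrow> real vec"
    and x :: "nat \<Rightarrow> real vec"
    and \<beta> \<gamma> \<beta>hat :: "real vec"
    and Q :: "real vec \<Rightarrow> real mat \<Rightarrow> real"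
    and \<alpha> \<tau> lam :: real
  assumes dims: "1 \<le> p" "1 \<le> d" "d \<le> T"
    and model: "var_model M p d T A \<Sigma> X \<epsilon>"
    and realization: "\<omega> \<in> space M" "x = (\<lambda>t. X t \<omega>)"
    and N_def: "N = T - d + 1"
    and q_def: "q = d * p\<^sup>2"
    and \<beta>_def: "\<beta> = stack_cols (coeff_mat p d A)"
    and sparse: "card (supp \<beta>) = k"
    and W_cases: "W = 1\<^sub>m p \<or> (W \<in> carrier_mat p p \<and> inverts_mat \<Sigma> W \<and> inverts_mat W \<Sigma>)"
    and \<Gamma>_def: "\<Gamma> = Gamma_hat p d T x W"
    and \<gamma>_def: "\<gamma> = gamma_hat p d T x W"
    and pos: "\<alpha> > 0" "\<tau> > 0"
    and k_tau: "real k * \<tau> \<le> \<alpha> / 32"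
    and restricted_eigenvalue: "\<And>\<theta>. \<theta> \<in> carrier_vec q \<Longrightarrow>
        quad_form \<Gamma> \<theta> \<ge> \<alpha> * (l2_norm \<theta>)\<^sup>2 - \<tau> * (l1_norm \<theta>)\<^sup>2"
    and deviation: "linf_norm (\<gamma> - \<Gamma> *\<^sub>v \<beta>)
        \<le> Q \<beta> \<Sigma> * sqrt ((ln (real d) + 2 * ln (real p)) / real N)"
    and lambda_pos: "lam > 0"
    and lambda_ge: "lam \<ge> 4 * Q \<beta> \<Sigma> * sqrt ((ln (real d) + 2 * ln (real p)) / real N)"
    and solution: "is_arg_min (lasso_objective \<Gamma> \<gamma> lam) (\<lambda>b. b \<in> carrier_vec q) \<beta>hat"
  shows "l1_norm (\<beta>hat - \<beta>) \<le> 64 * real k * lam / \<alpha>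
     \<and> l2_norm (\<beta>hat - \<beta>) \<le> 16 * sqrt (real k) * lam / \<alpha>
     \<and> quad_form \<Gamma> (\<beta>hat - \<beta>) \<le> 128 * real k * lam\<^sup>2 / \<alpha>
     \<and> real (card (supp (threshold lam \<beta>hat) - supp \<beta>)) \<le> 192 * real k / \<alpha>"
proof -
  let ?C = "design_mat p d T x"
  have "pos_def_mat p \<Sigma>"
    using model by (rule var_model.cov_pos_def)
  \<comment> \<open>Both choices of weight are positive definite, which makes \<Gamma> symmetric and
    positive semidefinite, as the lasso argument requires.\<close>
  then have W: "pos_def_mat p W"
    using W_cases pos_def_mat_one pos_def_mat_inverse[of p \<Sigma> W]
    by (auto simp: inverts_mat_def pos_def_mat_def)
  then have Wc: "W \<in> carrier_mat p p" and WT: "W\<^sup>T = W"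
    by (auto simp: pos_def_mat_def)
  have C: "?C \<in> carrier_mat N (d * p)"
    by (simp add: design_mat_def N_def)
  \<comment> \<open>The Kronecker shape of the dimension: \<open>p\<close> blocks, one per response
    coordinate, each of length \<open>d * p\<close>.\<close>
  have q: "q = p * (d * p)"
    by (simp add: q_def power2_eq_square)
  have \<Gamma>: "\<Gamma> = kronecker W ((1 / real N) \<cdot>\<^sub>m (?C\<^sup>T * ?C))"
    by (simp add: \<Gamma>_def Gamma_hat_def N_def)
  have \<Gamma>c: "\<Gamma> \<in> carrier_mat q q"
    using Wc C by (auto simp: \<Gamma> kronecker_def q)
  have "((1 / real N) \<cdot>\<^sub>m (?C\<^sup>T * ?C))\<^sup>T = (1 / real N) \<cdot>\<^sub>m (?C\<^sup>T * ?C)"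
    using C by (intro eq_matI) (simp_all add: scalar_prod_def mult.commute)
  then have \<Gamma>T: "\<Gamma>\<^sup>T = \<Gamma>"
    by (simp add: \<Gamma> kronecker_transpose WT)
  have \<Gamma>_nonneg: "0 \<le> quad_form \<Gamma> v" if "v \<in> carrier_vec q" for v
    unfolding \<Gamma> using that
    by (intro quad_form_kronecker_gram_nonneg[OF Wc quad_form_nonneg[OF W] C]) (auto simp: q)
  have \<gamma>: "\<gamma> \<in> carrier_vec q"
    using Wc C by (intro carrier_vecI) (auto simp: \<gamma>_def gamma_hat_def kronecker_def q)
  have \<beta>: "\<beta> \<in> carrier_vec q"
    by (intro carrier_vecI) (simp add: \<beta>_def stack_cols_def coeff_mat_def q)
  \<comment> \<open>The factor 4 in the lower bound on \<open>lam\<close> is what produces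
    \<open>lam / 4\<close>.\<close>
  have dev: "linf_norm (\<gamma> - \<Gamma> *\<^sub>v \<beta>) \<le> lam / 4"
    using deviation lambda_ge by linarith
  have \<tau>: "\<tau> \<ge> 0"
    using pos by simp
  note bounds = lasso_error_bounds[OF \<Gamma>c \<Gamma>T \<Gamma>_nonneg \<gamma> \<beta> sparse pos(1) \<tau> k_tau
      restricted_eigenvalue lambda_pos dev solution]
  \<comment> \<open>The lasso lemma gives the constants 12, 3, 9/2 and 9, which are relaxed to the
    stated 64, 16, 128 and 192.\<close>
  have weaken: "c * y / \<alpha> \<le> c' * y / \<alpha>" if "c \<le> c'" "0 \<le> y" for c c' y
    using that pos(1) by (intro divide_right_mono mult_right_mono) auto
  show ?thesis
    using bounds weaken[of 12 64 "real k * lam"] weaken[of 3 16 "sqrt (real k) * lam"]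
      weaken[of "9 / 2" 128 "real k * lam\<^sup>2"] weaken[of 9 192 "real k"] lambda_pos
    by (simp add: mult.assoc)
qed

end
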